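(* Let $\epsilon>0$ and let $u,\theta,\psi:(-\epsilon,\epsilon)\to\mathbb R$ be differentiable functions such that $a_ju(t)+1>0$ for $j=1,\ldots,m$ and all $t\in(-\epsilon,\epsilon)$, and which satisfy \[\frac{du}{dt}=2Q(u)^{1/2}\cos\theta,\] \[\frac{d\theta}{dt}=-Q(u)^{1/2}\sin\theta\sum_{j=1}^m\frac{a_j}{a_ju+1},\] \[\frac{d\psi}{dt}=-Q(u)^{1/2}\sin\theta\sum_{j=1}^m\frac{a_j^2}{a_ju+1}.\] Define $N\subset\mathbb C^m$ to be the set of points \[\bigl(re^{i\alpha_1}\sqrt{a_1u(t)+1},\ldots,re^{i\alpha_m}\sqrt{a_mu(t)+1}\bigr)\] with $r>0$, $t\in(-\epsilon,\epsilon)$, $\alpha_j\in\mathbb R$, $\alpha_1+\cdots+\alpha_m=\theta(t)$ and $a_1\alpha_1+\cdots+a_m\alpha_m=\psi(t)$. Then $N$ is a special Lagrangian submanifold of $\mathbb C^m$ with phase $i^{m-2}$.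
   Context: Standing assumptions: $m\ge3$, and $a_1\le\cdots\le a_m$ are integers, not all zero, with highest common factor $1$ and $a_1+\cdots+a_m=0$. $Q(u)=\prod_{j=1}^m(a_ju+1)$. $\mathbb C^m$ carries the metric $g=\sum_j|dz_j|^2$, the Kähler form $\omega=\frac i2\sum_j dz_j\wedge d\bar z_j$ and $\Omega=dz_1\wedge\cdots\wedge dz_m$. An oriented real $m$-dimensional submanifold $L$ is special Lagrangian with phase $e^{i\theta}$ if $(\cos\theta\,\mathrm{Re}\,\Omega+\sin\theta\,\mathrm{Im}\,\Omega)|_L$ equals the induced volume form. *)

theory Defs
  imports "HOL-Analysis.Analysis"
begin

text \<open>The polynomial Q(u) = prod_j (a_j u + 1).\<close>
definition Qpoly :: "('m::finite \<Rightarrow> int) \<Rightarrow> real \<Rightarrow> real" where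
  "Qpoly a u = (\<Prod>j\<in>UNIV. of_int (a j) * u + 1)"

text \<open>C^k maps on an open set (k-fold Frechet differentiable with continuous k-th derivative),
  and smooth (C-infinity) maps.\<close>
fun Ck_on :: "nat \<Rightarrow> 'a::real_normed_vector set \<Rightarrow> ('a \<Rightarrow> 'b::real_normed_vector) \<Rightarrow> bool" where
  "Ck_on 0 U f = continuous_on U f"
| "Ck_on (Suc k) U f =
     (\<exists>f'. (\<forall>x\<in>U. (f has_derivative f' x) (at x)) \<and> (\<forall>v. Ck_on k U (\<lambda>x. f' x v)))"

definition smooth_on :: "'a::real_normed_vector set \<Rightarrow> ('a \<Rightarrow> 'b::real_normed_vector) \<Rightarrow> bool" where
  "smooth_on U f \<longleftrightarrow> (\<forall>k. Ck_on k U f)"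

text \<open>Holomorphic volume form Omega = dz_1 ^ ... ^ dz_m evaluated on the tangent vectors
  D(e_1),...,D(e_m) of a linear map D : R^m -> C^m.\<close>
definition Omega_on :: "((real^'m::finite) \<Rightarrow> complex^'m) \<Rightarrow> complex" where
  "Omega_on D = det (\<chi> j k. D (axis k 1) $ j)"

text \<open>Induced (Riemannian) volume form of g on the same tangent vectors: sqrt of the Gram determinant.\<close>
definition vol_on :: "((real^'m::finite) \<Rightarrow> complex^'m) \<Rightarrow> real" where
  "vol_on D = sqrt (det (\<chi> j k. D (axis j 1) \<bullet> D (axis k 1) :: real^'m^'m))"

text \<open>N is an (immersed) special Lagrangian m-fold with phase ph: N is the image of a smooth
  immersion of a second countable oriented m-manifold whose orientation makes
  (cos th Re Omega + sin th Im Omega) = Re (cnj ph * Omega) equal to the induced volume form.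
  Equivalently (covering the manifold by countably many oriented charts), N is the union of
  countably many such oriented parametrised patches.\<close>
definition special_lagrangian :: "complex \<Rightarrow> (complex^'m::finite) set \<Rightarrow> bool" where
  "special_lagrangian ph N \<longleftrightarrow>
     (\<exists>(U :: nat \<Rightarrow> (real^'m) set) (\<phi> :: nat \<Rightarrow> real^'m \<Rightarrow> complex^'m) (I :: nat set).
        N = (\<Union>i\<in>I. \<phi> i ` U i) \<and>
        (\<forall>i\<in>I. open (U i) \<and> smooth_on (U i) (\<phi> i) \<and>
           (\<forall>x\<in>U i. (\<phi> i) differentiable (at x) \<and>
               inj (frechet_derivative (\<phi> i) (at x)) \<and>
               Re (cnj ph * Omega_on (frechet_derivative (\<phi> i) (at x)))
                 = vol_on (frechet_derivative (\<phi> i) (at x)))))"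

end

theory Submission
  imports Defs
begin

text \<open>Write z_j = r e^(i \<alpha>_j) sqrt (a_j u(t) + 1) and pick p, q with a_p < 0 < a_q. The two
  constraints on the angles determine \<alpha>_p and \<alpha>_q, so r, t and the remaining angles are
  global coordinates on N. A tangent vector has components z_j times a logarithmic derivative,
  whose real part comes from r and t and whose imaginary part from the angles. The Kahler form
  vanishes on such vectors because u \<psi>' + \<theta>' = 0, which is where \<Sum>j a_j = 0 enters; hence the
  induced volume is |\<Omega>|. Adding up the rows of the matrix of logarithmic derivatives, plain and
  weighted by a_j, only \<theta>' and \<psi>' survive in the angle columns, and the determinant collapses to
  \<Omega> = i^(m-2) r^(m-1) m Q(u) S_2(u) / (a_q - a_p) with S_2(u) = \<Sum>j a_j^2 / (a_j u + 1) > 0.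
  Finally (u, \<theta>, \<psi>) solves an ODE with smooth right-hand side, so it is smooth, and so is the
  chart.\<close>

section \<open>Smooth maps\<close>

named_theorems Ck_on_intros

lemma Ck_on_SucI:
  assumes "\<And>x. x \<in> U \<Longrightarrow> (f has_derivative f' x) (at x)" and "\<And>v. Ck_on k U (\<lambda>x. f' x v)"
  shows "Ck_on (Suc k) U f"
  using assms by auto

lemma Ck_on_SucD: "Ck_on (Suc k) U f \<Longrightarrow> Ck_on k U f"
proof (induction k arbitrary: f)
  case 0
  then obtain f' where "\<forall>x\<in>U. (f has_derivative f' x) (at x)"
    by auto
  then show ?case
    by (auto intro!: continuous_at_imp_continuous_on has_derivative_continuous)
next
  case (Suc k)
  then obtain f' where "\<forall>x\<in>U. (f has_derivative f' x) (at x)" "\<forall>v. Ck_on (Suc k) U (\<lambda>x. f' x v)"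
    by auto
  with Suc.IH show ?case
    by (intro Ck_on_SucI[where f' = f']) auto
qed

lemma Ck_on_bounded_linear:
  assumes "bounded_linear L"
  shows "Ck_on k U f \<Longrightarrow> Ck_on k U (\<lambda>x. L (f x))"
proof (induction k arbitrary: f)
  case 0
  then show ?case
    using bounded_linear.continuous_on[OF assms] by simp
next
  case (Suc k)
  then obtain f' where "\<forall>x\<in>U. (f has_derivative f' x) (at x)" "\<forall>v. Ck_on k U (\<lambda>x. f' x v)"
    by auto
  with Suc.IH show ?case
    by (intro Ck_on_SucI[where f' = "\<lambda>x v. L (f' x v)"] bounded_linear.has_derivative[OF assms])
      auto
qed

lemma Ck_on_const [Ck_on_intros]: "Ck_on k U (\<lambda>x. c)"
  by (induction k arbitrary: c) (auto intro!: exI[of _ "\<lambda>x v. 0"])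

lemma Ck_on_ident [Ck_on_intros]: "Ck_on k U (\<lambda>x. x)"
  by (induction k) (auto intro!: exI[of _ "\<lambda>x v. v"] Ck_on_const)

lemma Ck_on_add [Ck_on_intros]: "Ck_on k U f \<Longrightarrow> Ck_on k U g \<Longrightarrow> Ck_on k U (\<lambda>x. f x + g x)"
proof (induction k arbitrary: f g)
  case 0
  then show ?case by (simp add: continuous_on_add)
next
  case (Suc k)
  then obtain f' g' where
    "\<forall>x\<in>U. (f has_derivative f' x) (at x)" "\<forall>v. Ck_on k U (\<lambda>x. f' x v)"
    "\<forall>x\<in>U. (g has_derivative g' x) (at x)" "\<forall>v. Ck_on k U (\<lambda>x. g' x v)"
    by auto
  with Suc.IH show ?case
    by (intro Ck_on_SucI[where f' = "\<lambda>x v. f' x v + g' x v"] has_derivative_add) auto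
qed

lemma Ck_on_bounded_bilinear:
  assumes "bounded_bilinear bil"
  shows "Ck_on k U f \<Longrightarrow> Ck_on k U g \<Longrightarrow> Ck_on k U (\<lambda>x. bil (f x) (g x))"
proof (induction k arbitrary: f g)
  case 0
  then show ?case
    using bounded_bilinear.continuous_on[OF assms] by simp
next
  case (Suc k)
  then obtain f' g' where
    f': "\<forall>x\<in>U. (f has_derivative f' x) (at x)" "\<forall>v. Ck_on k U (\<lambda>x. f' x v)" and
    g': "\<forall>x\<in>U. (g has_derivative g' x) (at x)" "\<forall>v. Ck_on k U (\<lambda>x. g' x v)"
    by auto
  have "Ck_on k U f" "Ck_on k U g"
    using Suc.prems Ck_on_SucD by blast+
  with f' g' Suc.IH show ?case
    by (intro Ck_on_SucI[where f' = "\<lambda>x v. bil (f x) (g' x v) + bil (f' x v) (g x)"]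
        bounded_bilinear.FDERIV[OF assms] Ck_on_add) auto
qed

lemma Ck_on_mult [Ck_on_intros]:
  "Ck_on k U f \<Longrightarrow> Ck_on k U g \<Longrightarrow> Ck_on k U (\<lambda>x. f x * (g x :: 'a::real_normed_algebra))"
  by (rule Ck_on_bounded_bilinear[OF bounded_bilinear_mult])

lemma Ck_on_scaleR [Ck_on_intros]:
  "Ck_on k U f \<Longrightarrow> Ck_on k U g \<Longrightarrow> Ck_on k U (\<lambda>x. f x *\<^sub>R g x)"
  by (rule Ck_on_bounded_bilinear[OF bounded_bilinear_scaleR])

lemma Ck_on_minus [Ck_on_intros]: "Ck_on k U f \<Longrightarrow> Ck_on k U (\<lambda>x. - f x)"
  by (rule Ck_on_bounded_linear[OF bounded_linear_minus[OF bounded_linear_ident]])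

lemma Ck_on_diff [Ck_on_intros]: "Ck_on k U f \<Longrightarrow> Ck_on k U g \<Longrightarrow> Ck_on k U (\<lambda>x. f x - g x)"
  unfolding diff_conv_add_uminus by (intro Ck_on_add Ck_on_minus)

lemma Ck_on_of_real [Ck_on_intros]: "Ck_on k U f \<Longrightarrow> Ck_on k U (\<lambda>x. of_real (f x))"
  by (rule Ck_on_bounded_linear[OF bounded_linear_of_real])

lemma Ck_on_vec_nth [Ck_on_intros]: "Ck_on k U (\<lambda>x. x $ i)"
  by (rule Ck_on_bounded_linear[OF bounded_linear_vec_nth Ck_on_ident])

lemma Ck_on_fst [Ck_on_intros]: "Ck_on k U f \<Longrightarrow> Ck_on k U (\<lambda>x. fst (f x))"
  by (rule Ck_on_bounded_linear[OF bounded_linear_fst])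

lemma Ck_on_snd [Ck_on_intros]: "Ck_on k U f \<Longrightarrow> Ck_on k U (\<lambda>x. snd (f x))"
  by (rule Ck_on_bounded_linear[OF bounded_linear_snd])

lemma Ck_on_sum [Ck_on_intros]:
  "finite S \<Longrightarrow> (\<And>i. i \<in> S \<Longrightarrow> Ck_on k U (f i)) \<Longrightarrow> Ck_on k U (\<lambda>x. \<Sum>i\<in>S. f i x)"
  by (induction S rule: finite_induct) (auto intro: Ck_on_const Ck_on_add)

lemma Ck_on_prod [Ck_on_intros]:
  "finite S \<Longrightarrow> (\<And>i. i \<in> S \<Longrightarrow> Ck_on k U (f i)) \<Longrightarrow>
   Ck_on k U (\<lambda>x. \<Prod>i\<in>S. (f i x :: 'a::real_normed_field))"
  by (induction S rule: finite_induct) (auto intro: Ck_on_const Ck_on_mult)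

lemma Ck_on_Pair [Ck_on_intros]: "Ck_on k U f \<Longrightarrow> Ck_on k U g \<Longrightarrow> Ck_on k U (\<lambda>x. (f x, g x))"
proof (induction k arbitrary: f g)
  case 0
  then show ?case by (simp add: continuous_on_Pair)
next
  case (Suc k)
  then obtain f' g' where
    "\<forall>x\<in>U. (f has_derivative f' x) (at x)" "\<forall>v. Ck_on k U (\<lambda>x. f' x v)"
    "\<forall>x\<in>U. (g has_derivative g' x) (at x)" "\<forall>v. Ck_on k U (\<lambda>x. g' x v)"
    by auto
  with Suc.IH show ?case
    by (intro Ck_on_SucI[where f' = "\<lambda>x v. (f' x v, g' x v)"] has_derivative_Pair) auto
qed

lemma vec_lambda_eq_sum_axis:
  "(\<chi> j. f j) = (\<Sum>j\<in>UNIV. axis j (f j) :: 'a::comm_monoid_add^'n::finite)"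
  by (simp add: vec_eq_iff sum_component axis_def if_distrib cong: if_cong)

lemma bounded_linear_axis: "bounded_linear (axis j :: 'a::euclidean_space \<Rightarrow> 'a^'n::finite)"
  unfolding linear_conv_bounded_linear[symmetric]
  by (rule linearI) (simp_all add: vec_eq_iff axis_def)

lemma Ck_on_vec_lambda [Ck_on_intros]:
  "(\<And>j. Ck_on k U (f j)) \<Longrightarrow> Ck_on k U (\<lambda>x. \<chi> j. (f j x :: 'a::euclidean_space))"
  unfolding vec_lambda_eq_sum_axis
  by (intro Ck_on_sum Ck_on_bounded_linear[OF bounded_linear_axis]) auto

lemma has_derivative_vec_lambda:
  "(\<And>j. (f j has_derivative f' j) F) \<Longrightarrow>
    ((\<lambda>x. \<chi> j. (f j x :: 'a::euclidean_space)) has_derivative (\<lambda>v. \<chi> j. f' j v)) F"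
  unfolding vec_lambda_eq_sum_axis
  by (intro has_derivative_sum bounded_linear.has_derivative[OF bounded_linear_axis])

lemma has_derivative_vec_nth [derivative_intros]: "((\<lambda>x. x $ i) has_derivative (\<lambda>v. v $ i)) F"
  by (rule bounded_linear_imp_has_derivative[OF bounded_linear_vec_nth])

lemma axis_nth_if: "axis k c $ i = (if i = k then c else 0)"
  by (simp add: axis_def)

lemma Ck_on_compose:
  fixes g :: "'b::euclidean_space \<Rightarrow> 'c::real_normed_vector"
  shows "Ck_on k V g \<Longrightarrow> Ck_on k U f \<Longrightarrow> (\<And>x. x \<in> U \<Longrightarrow> f x \<in> V) \<Longrightarrow>
    Ck_on k U (\<lambda>x. g (f x))"
proof (induction k arbitrary: f g)
  case 0
  then show ?case
    using continuous_on_compose2[of V g U f] by auto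
next
  case (Suc k)
  then obtain f' g' where
    f': "\<forall>x\<in>U. (f has_derivative f' x) (at x)" "\<forall>v. Ck_on k U (\<lambda>x. f' x v)" and
    g': "\<forall>y\<in>V. (g has_derivative g' y) (at y)" "\<forall>w. Ck_on k V (\<lambda>y. g' y w)"
    by auto
  \<comment> \<open>expanding f' x v in the basis turns the chain-rule derivative g' (f x) (f' x v) into a
     finite sum of products of C^k functions\<close>
  define h where "h x v = (\<Sum>b\<in>Basis. (f' x v \<bullet> b) *\<^sub>R g' (f x) b)" for x v
  have "((\<lambda>x. g (f x)) has_derivative h x) (at x)" if "x \<in> U" for x
  proof -
    have "linear (g' (f x))"
      using g' Suc.prems(3) that has_derivative_linear by blast
    then have expand:
      "g' (f x) (\<Sum>b\<in>Basis. (w \<bullet> b) *\<^sub>R b) = (\<Sum>b\<in>Basis. (w \<bullet> b) *\<^sub>R g' (f x) b)" for w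
      by (simp only: linear_sum linear_scale)
    have "h x = (\<lambda>v. g' (f x) (f' x v))"
      unfolding h_def expand[symmetric] euclidean_representation ..
    then show ?thesis
      using has_derivative_compose[of f "f' x" x UNIV g "g' (f x)"] f' g' Suc.prems(3) that
      by simp
  qed
  moreover have "Ck_on k U (\<lambda>x. h x v)" for v
  proof -
    have "Ck_on k U f"
      using Suc.prems(2) Ck_on_SucD by blast
    then have "Ck_on k U (\<lambda>x. g' (f x) b)" for b
      using Suc.IH[of "\<lambda>y. g' y b" f] g'(2) Suc.prems(3) by blast
    then show ?thesis
      unfolding h_def using f'(2)
      by (intro Ck_on_sum Ck_on_scaleR Ck_on_bounded_linear[OF bounded_linear_inner_left]) auto
  qed
  ultimately show ?case
    by (rule Ck_on_SucI)
qed

lemma Ck_on_Suc_field_derivative: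
  fixes g :: "'a::real_normed_field \<Rightarrow> 'a"
  assumes "\<And>x. x \<in> S \<Longrightarrow> (g has_field_derivative g' x) (at x)" and "Ck_on k S g'"
  shows "Ck_on (Suc k) S g"
  using assms by (intro Ck_on_SucI[where f' = "\<lambda>x v. g' x * v"] Ck_on_mult Ck_on_const)
    (auto simp: has_field_derivative_def)

lemma Ck_on_sin_cos: "Ck_on k S (sin :: real \<Rightarrow> real) \<and> Ck_on k S (cos :: real \<Rightarrow> real)"
proof (induction k)
  case 0
  then show ?case by (auto intro: continuous_intros)
next
  case (Suc k)
  have "Ck_on (Suc k) S (sin :: real \<Rightarrow> real)"
    by (rule Ck_on_Suc_field_derivative[where g' = cos]) (use Suc in \<open>auto intro: DERIV_sin\<close>)
  moreover have "Ck_on (Suc k) S (cos :: real \<Rightarrow> real)"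
    by (rule Ck_on_Suc_field_derivative[where g' = "\<lambda>x. - sin x"])
      (use Suc in \<open>auto intro: DERIV_cos Ck_on_minus\<close>)
  ultimately show ?case ..
qed

lemma Ck_on_exp_base: "Ck_on k S (exp :: 'a::{real_normed_field,banach} \<Rightarrow> 'a)"
proof (induction k)
  case 0
  then show ?case by (auto intro: continuous_intros)
next
  case (Suc k)
  then show ?case
    by (rule Ck_on_Suc_field_derivative[rotated]) (rule DERIV_exp)
qed

lemma Ck_on_inverse_base: "Ck_on k {x::real. x \<noteq> 0} inverse"
proof (induction k)
  case 0
  then show ?case by (auto intro!: continuous_intros)
next
  case (Suc k)
  then show ?case
    by (intro Ck_on_Suc_field_derivative[where g' = "\<lambda>x. - (inverse x * inverse x)"]
        Ck_on_minus Ck_on_mult) (auto intro!: derivative_eq_intros simp: power2_eq_square)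
qed

lemma Ck_on_inverse [Ck_on_intros]:
  "Ck_on k U f \<Longrightarrow> (\<And>x. x \<in> U \<Longrightarrow> f x \<noteq> (0::real)) \<Longrightarrow> Ck_on k U (\<lambda>x. inverse (f x))"
  by (rule Ck_on_compose[OF Ck_on_inverse_base]) auto

lemma Ck_on_divide [Ck_on_intros]:
  "Ck_on k U f \<Longrightarrow> Ck_on k U g \<Longrightarrow> (\<And>x. x \<in> U \<Longrightarrow> g x \<noteq> (0::real)) \<Longrightarrow>
    Ck_on k U (\<lambda>x. f x / g x)"
  unfolding divide_inverse by (intro Ck_on_mult Ck_on_inverse)

lemma Ck_on_ln_base: "Ck_on k {0::real<..} ln"
proof (cases k)
  case 0
  then show ?thesis by (auto intro!: continuous_intros)
next
  case (Suc n)
  have "Ck_on n {0::real<..} inverse"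
    by (rule Ck_on_inverse[OF Ck_on_ident]) auto
  then show ?thesis
    unfolding Suc by (rule Ck_on_Suc_field_derivative[rotated]) (auto intro: DERIV_ln)
qed

lemma Ck_on_sqrt_base: "Ck_on k {0::real<..} sqrt"
proof (induction k)
  case 0
  then show ?case by (auto intro!: continuous_intros)
next
  case (Suc k)
  have "Ck_on k {0<..} (\<lambda>x. inverse (sqrt x) / 2)"
    by (intro Ck_on_divide Ck_on_const Ck_on_inverse Suc.IH) auto
  then show ?case
    by (rule Ck_on_Suc_field_derivative[rotated]) (rule DERIV_real_sqrt, simp)
qed

lemma Ck_on_sin [Ck_on_intros]: "Ck_on k U f \<Longrightarrow> Ck_on k U (\<lambda>x. sin (f x :: real))"
  by (rule Ck_on_compose[OF conjunct1[OF Ck_on_sin_cos[of k UNIV]]]) auto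

lemma Ck_on_cos [Ck_on_intros]: "Ck_on k U f \<Longrightarrow> Ck_on k U (\<lambda>x. cos (f x :: real))"
  by (rule Ck_on_compose[OF conjunct2[OF Ck_on_sin_cos[of k UNIV]]]) auto

lemma Ck_on_exp [Ck_on_intros]:
  "Ck_on k U f \<Longrightarrow> Ck_on k U (\<lambda>x. exp (f x :: 'a::{real_normed_field,banach,euclidean_space}))"
  by (rule Ck_on_compose[OF Ck_on_exp_base]) auto

lemma Ck_on_ln [Ck_on_intros]:
  "Ck_on k U f \<Longrightarrow> (\<And>x. x \<in> U \<Longrightarrow> f x > (0::real)) \<Longrightarrow> Ck_on k U (\<lambda>x. ln (f x))"
  by (rule Ck_on_compose[OF Ck_on_ln_base]) auto

lemma Ck_on_sqrt [Ck_on_intros]: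
  "Ck_on k U f \<Longrightarrow> (\<And>x. x \<in> U \<Longrightarrow> f x > (0::real)) \<Longrightarrow> Ck_on k U (\<lambda>x. sqrt (f x))"
  by (rule Ck_on_compose[OF Ck_on_sqrt_base]) auto

lemma Ck_on_ode_solution:
  fixes y :: "real \<Rightarrow> 'a::euclidean_space"
  assumes "\<And>t. t \<in> I \<Longrightarrow> (y has_vector_derivative F (y t)) (at t)"
    and "\<And>t. t \<in> I \<Longrightarrow> y t \<in> V"
    and "\<And>k. Ck_on k V F"
  shows "Ck_on k I y"
proof (induction k)
  case 0
  then show ?case
    using assms(1) by (auto intro!: continuous_at_imp_continuous_on has_derivative_continuous
        simp: has_vector_derivative_def)
next
  case (Suc k)
  have "Ck_on k I (\<lambda>t. F (y t))"
    using Ck_on_compose[OF assms(3) Suc.IH] assms(2) by blast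
  then show ?case
    using assms(1)
    by (intro Ck_on_SucI[where f' = "\<lambda>t v. v *\<^sub>R F (y t)"] Ck_on_scaleR Ck_on_const)
      (auto simp: has_vector_derivative_def)
qed

section \<open>Calibrated frames\<close>

lemma prod_UNIV_split_two:
  fixes f :: "'n::finite \<Rightarrow> 'a::comm_monoid_mult"
  assumes "p \<noteq> q"
  shows "(\<Prod>i\<in>UNIV. f i) = f p * f q * (\<Prod>i\<in>-{p,q}. f i)"
proof -
  have "(\<Prod>i\<in>UNIV. f i) = (\<Prod>i\<in>insert p (insert q (-{p,q})). f i)"
    by (rule prod.cong) auto
  then show ?thesis
    using assms by (simp add: mult.assoc)
qed

lemma sum_UNIV_split_two:
  fixes f :: "'n::finite \<Rightarrow> 'a::comm_monoid_add"
  assumes "p \<noteq> q"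
  shows "(\<Sum>i\<in>UNIV. f i) = f p + f q + (\<Sum>i\<in>-{p,q}. f i)"
proof -
  have "(\<Sum>i\<in>UNIV. f i) = (\<Sum>i\<in>insert p (insert q (-{p,q})). f i)"
    by (rule sum.cong) auto
  then show ?thesis
    using assms by (simp add: add.assoc)
qed

lemma det_diagonal_outside_two_rows:
  fixes A :: "'a::comm_ring_1^'n::finite^'n"
  assumes pq: "p \<noteq> q"
    and diag: "\<And>i j. i \<notin> {p,q} \<Longrightarrow> A$i$j = (if j = i then d i else 0)"
  shows "det A = (\<Prod>i\<in>-{p,q}. d i) * (A$p$p * A$q$q - A$p$q * A$q$p)"
proof -
  let ?f = "\<lambda>\<sigma>. of_int (sign \<sigma>) * (\<Prod>i\<in>UNIV. A$i$\<sigma> i)"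
  have vanish: "?f \<sigma> = 0" if perm: "\<sigma> permutes UNIV" and not_perm: "\<not> \<sigma> permutes {p,q}" for \<sigma>
  proof -
    obtain i where "i \<notin> {p,q}" "\<sigma> i \<noteq> i"
      using permutes_superset[OF perm] not_perm by blast
    then have "A$i$\<sigma> i = 0"
      using diag by simp
    then have "(\<Prod>i\<in>UNIV. A$i$\<sigma> i) = 0"
      by (intro prod_zero) auto
    then show ?thesis
      by simp
  qed
  have "det A = sum ?f {\<sigma>. \<sigma> permutes UNIV}"
    by (simp add: det_def)
  also have "\<dots> = sum ?f {\<sigma>. \<sigma> permutes {p,q}}"
    by (rule sum.mono_neutral_right) (auto intro: permutes_subset vanish)
  also have "\<dots> = ?f id + ?f (Transposition.transpose p q)"
    using pq by (simp add: sum_over_permutations_insert)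
  also have "?f id = (\<Prod>i\<in>-{p,q}. d i) * (A$p$p * A$q$q)"
    using diag by (simp add: prod_UNIV_split_two[OF pq] sign_id ac_simps)
  also have "?f (Transposition.transpose p q) = - ((\<Prod>i\<in>-{p,q}. d i) * (A$p$q * A$q$p))"
    using diag pq by (simp add: prod_UNIV_split_two[OF pq] sign_swap_id ac_simps transpose_def)
  finally show ?thesis
    by (simp add: algebra_simps)
qed

lemma det_map_cnj: "det (\<chi> i j. cnj (A$i$j)) = cnj (det (A :: complex^'n::finite^'n))"
  unfolding det_def by (simp add: cnj_sum cnj_prod)

lemma det_map_of_real:
  "det (\<chi> i j. of_real (A$i$j)) = (of_real (det (A :: real^'n::finite^'n)) :: complex)"
  unfolding det_def by (simp add: of_real_sum of_real_prod)

text \<open>The Kahler form \<omega> = (i/2) \<Sum>j dz_j \<and> d(cnj z_j), evaluated on two vectors.\<close>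
definition kahler_form :: "complex^'m::finite \<Rightarrow> complex^'m \<Rightarrow> real" where
  "kahler_form v w = (\<Sum>j\<in>UNIV. Im (cnj (v$j) * w$j))"

text \<open>On an isotropic frame the Hermitian Gram matrix (cnj M)^T M is real, so it is the Riemannian
  Gram matrix, whose determinant is therefore |det M|^2.\<close>
lemma vol_on_eq_cmod_Omega_on:
  fixes D :: "real^'m::finite \<Rightarrow> complex^'m"
  assumes isotropic: "\<And>v w. kahler_form (D v) (D w) = 0"
  shows "vol_on D = cmod (Omega_on D)"
proof -
  let ?G = "\<chi> k l. D (axis k 1) \<bullet> D (axis l 1) :: real^'m^'m"
  let ?M = "\<chi> j k. D (axis k 1) $ j :: complex^'m^'m"
  have "of_real (D v \<bullet> D w) = (\<Sum>j\<in>UNIV. cnj (D v $ j) * D w $ j)" for v w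
    using isotropic[of v w]
    by (simp add: complex_eq_iff Re_sum Im_sum kahler_form_def inner_vec_def inner_complex_def)
  then have Gram: "(\<chi> k l. of_real (?G$k$l)) = transpose (\<chi> j k. cnj (?M$j$k)) ** ?M"
    by (simp add: vec_eq_iff matrix_matrix_mult_def transpose_def)
  have "of_real (det ?G) = det (\<chi> k l. (of_real (?G$k$l) :: complex))"
    by (rule det_map_of_real[symmetric])
  also have "\<dots> = cnj (det ?M) * det ?M"
    unfolding Gram det_mul det_transpose det_map_cnj ..
  also have "\<dots> = of_real ((cmod (det ?M))\<^sup>2)"
    by (metis complex_norm_square mult.commute of_real_power)
  finally have "det ?G = (cmod (det ?M))\<^sup>2"
    using of_real_eq_iff by blast
  then show ?thesis
    by (simp add: vol_on_def Omega_on_def)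
qed

lemma inj_if_Omega_on_nonzero:
  fixes D :: "real^'m::finite \<Rightarrow> complex^'m"
  assumes lin: "linear D" and nz: "Omega_on D \<noteq> 0"
  shows "inj D"
proof -
  let ?M = "\<chi> j k. D (axis k 1) $ j :: complex^'m^'m"
  have coords: "D v = ?M *v (\<chi> k. of_real (v$k))" for v
  proof -
    have "v = (\<Sum>k\<in>UNIV. v$k *\<^sub>R axis k 1)"
      using basis_expansion[of v] by (simp add: scalar_mult_eq_scaleR)
    then have "D v = D (\<Sum>k\<in>UNIV. v$k *\<^sub>R axis k 1)"
      by simp
    also have "\<dots> = (\<Sum>k\<in>UNIV. v$k *\<^sub>R D (axis k 1))"
      using lin by (simp add: linear_sum linear_scale)
    finally show ?thesis
      by (simp add: vec_eq_iff matrix_vector_mult_def sum_component)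
        (simp add: scaleR_conv_of_real mult.commute)
  qed
  have "inj ((*v) ?M)"
    using nz by (intro inj_matrix_vector_mult) (simp add: invertible_det_nz Omega_on_def)
  show ?thesis
  proof (rule injI)
    fix v w
    assume "D v = D w"
    then have "?M *v (\<chi> k. of_real (v$k)) = ?M *v (\<chi> k. of_real (w$k))"
      by (simp only: coords[of v, symmetric] coords[of w, symmetric])
    then have "(\<chi> k. of_real (v$k)) = (\<chi> k. (of_real (w$k) :: complex))"
      by (rule injD[OF \<open>inj ((*v) ?M)\<close>])
    then show "v = w"
      by (simp add: vec_eq_iff)
  qed
qed

lemma special_lagrangian_image:
  fixes \<phi> :: "real^'m::finite \<Rightarrow> complex^'m"
  assumes "open U" and "smooth_on U \<phi>"
    and deriv: "\<And>x. x \<in> U \<Longrightarrow> (\<phi> has_derivative D x) (at x)"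
    and lagrangian: "\<And>x v w. x \<in> U \<Longrightarrow> kahler_form (D x v) (D x w) = 0"
    and phase: "\<And>x. x \<in> U \<Longrightarrow> \<exists>P>0. Omega_on (D x) = ph * of_real P"
    and unit: "cmod ph = 1"
  shows "special_lagrangian ph (\<phi> ` U)"
  unfolding special_lagrangian_def
proof (intro exI[of _ "\<lambda>_. U"] exI[of _ "\<lambda>_. \<phi>"] exI[of _ "{0::nat}"] conjI ballI)
  fix x assume "x \<in> U"
  then obtain P where "P > 0" and Omega: "Omega_on (D x) = ph * of_real P"
    using phase by blast
  have fd: "frechet_derivative \<phi> (at x) = D x"
    using deriv[OF \<open>x \<in> U\<close>] by (rule frechet_derivative_at[symmetric])
  have "cnj ph * ph = 1"
    using unit by (metis complex_norm_square mult.commute of_real_1 power_one)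
  then have "cnj ph * Omega_on (D x) = of_real P"
    unfolding Omega by (simp add: mult.assoc [symmetric])
  moreover have "vol_on (D x) = P"
    using vol_on_eq_cmod_Omega_on[OF lagrangian[OF \<open>x \<in> U\<close>]] Omega unit \<open>P > 0\<close>
    by (simp add: norm_mult)
  moreover have "Omega_on (D x) \<noteq> 0"
    using Omega unit \<open>P > 0\<close> by auto
  ultimately show "inj (frechet_derivative \<phi> (at x))"
    and "Re (cnj ph * Omega_on (frechet_derivative \<phi> (at x)))
      = vol_on (frechet_derivative \<phi> (at x))"
    using deriv[OF \<open>x \<in> U\<close>] by (simp_all add: fd inj_if_Omega_on_nonzero has_derivative_linear)
  show "\<phi> differentiable at x"
    using deriv[OF \<open>x \<in> U\<close>] by (auto simp: differentiable_def)
qed (use assms in auto)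

section \<open>The special Lagrangian family\<close>

lemma linear_2x2_solution:
  fixes b c \<sigma> \<tau> :: real
  assumes "b \<noteq> c"
  shows "(c * \<sigma> - \<tau>) / (c - b) + (\<tau> - b * \<sigma>) / (c - b) = \<sigma>"
    and "b * ((c * \<sigma> - \<tau>) / (c - b)) + c * ((\<tau> - b * \<sigma>) / (c - b)) = \<tau>"
    and "y + z = \<sigma> \<Longrightarrow> b * y + c * z = \<tau> \<Longrightarrow>
      y = (c * \<sigma> - \<tau>) / (c - b) \<and> z = (\<tau> - b * \<sigma>) / (c - b)"
  using assms by (auto simp: divide_simps) (auto simp: algebra_simps)

lemma real_sqrt_prod: "sqrt (\<Prod>i\<in>S. f i) = (\<Prod>i\<in>S. sqrt (f i))"
  by (induction S rule: infinite_finite_induct) (auto simp: real_sqrt_mult)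

lemma Qpoly_pos: "(\<And>j. of_int (a j) * x + 1 > 0) \<Longrightarrow> Qpoly a x > 0"
  unfolding Qpoly_def by (rule prod_pos) auto

lemma exp_half_ln: "y > 0 \<Longrightarrow> exp (ln y / 2) = sqrt y"
  by (rule real_sqrt_unique[symmetric]) (auto simp: power2_eq_square simp flip: exp_add)

lemma sum_eq_0_obtains_neg_pos:
  fixes f :: "'a \<Rightarrow> 'b::linordered_ab_group_add"
  assumes "finite A" and "sum f A = 0" and "\<exists>j\<in>A. f j \<noteq> 0"
  obtains p q where "p \<in> A" "f p < 0" "q \<in> A" "f q > 0"
proof -
  have "\<exists>p\<in>A. f p < 0"
    using assms sum_nonneg_eq_0_iff[of A f] by (metis linorder_not_less)
  moreover have "\<exists>q\<in>A. - f q < 0"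
    using assms sum_nonneg_eq_0_iff[of A "\<lambda>j. - f j"]
    by (metis linorder_not_less neg_equal_0_iff_equal sum_negf)
  ultimately show ?thesis
    using that by (metis neg_less_0_iff_less)
qed

locale sl_evolution =
  fixes a :: "'m::finite \<Rightarrow> int" and \<epsilon> :: real and u \<theta> \<psi> :: "real \<Rightarrow> real" and p q :: 'm
  assumes a_p_neg: "a p < 0" and a_q_pos: "a q > 0"
    and sum_a: "(\<Sum>j\<in>UNIV. a j) = 0"
    and pos: "\<And>j t. t \<in> {-\<epsilon><..<\<epsilon>} \<Longrightarrow> of_int (a j) * u t + 1 > 0"
    and u_deriv: "\<And>t. t \<in> {-\<epsilon><..<\<epsilon>} \<Longrightarrow>
              (u has_real_derivative (2 * sqrt (Qpoly a (u t)) * cos (\<theta> t))) (at t)"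
    and theta_deriv: "\<And>t. t \<in> {-\<epsilon><..<\<epsilon>} \<Longrightarrow>
              (\<theta> has_real_derivative
                 (- sqrt (Qpoly a (u t)) * sin (\<theta> t) *
                    (\<Sum>j\<in>UNIV. of_int (a j) / (of_int (a j) * u t + 1)))) (at t)"
    and psi_deriv: "\<And>t. t \<in> {-\<epsilon><..<\<epsilon>} \<Longrightarrow>
              (\<psi> has_real_derivative
                 (- sqrt (Qpoly a (u t)) * sin (\<theta> t) *
                    (\<Sum>j\<in>UNIV. (of_int (a j))\<^sup>2 / (of_int (a j) * u t + 1)))) (at t)"
begin

abbreviation "I \<equiv> {-\<epsilon><..<\<epsilon>}"
abbreviation "K \<equiv> - {p, q}"

lemma p_neq_q: "p \<noteq> q"
  using a_p_neg a_q_pos by auto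

lemma a_p_neq_a_q: "real_of_int (a p) \<noteq> of_int (a q)"
  using a_p_neg a_q_pos by simp

lemma card_K: "card K = CARD('m) - 2"
  using p_neq_q by (simp add: Compl_eq_Diff_UNIV card_Diff_subset)

lemma sum_a_real: "(\<Sum>j\<in>UNIV. real_of_int (a j)) = 0"
  using sum_a by (metis of_int_0 of_int_sum)

definition S1 :: "real \<Rightarrow> real" where
  "S1 x = (\<Sum>j\<in>UNIV. of_int (a j) / (of_int (a j) * x + 1))"

definition S2 :: "real \<Rightarrow> real" where
  "S2 x = (\<Sum>j\<in>UNIV. (of_int (a j))\<^sup>2 / (of_int (a j) * x + 1))"

definition u' :: "real \<Rightarrow> real" where
  "u' t = 2 * sqrt (Qpoly a (u t)) * cos (\<theta> t)"

definition \<theta>' :: "real \<Rightarrow> real" where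
  "\<theta>' t = - sqrt (Qpoly a (u t)) * sin (\<theta> t) * S1 (u t)"

definition \<psi>' :: "real \<Rightarrow> real" where
  "\<psi>' t = - sqrt (Qpoly a (u t)) * sin (\<theta> t) * S2 (u t)"

lemma derivatives:
  assumes "t \<in> I"
  shows "(u has_real_derivative u' t) (at t)" "(\<theta> has_real_derivative \<theta>' t) (at t)"
    "(\<psi> has_real_derivative \<psi>' t) (at t)"
  using u_deriv theta_deriv psi_deriv assms by (simp_all add: u'_def \<theta>'_def \<psi>'_def S1_def S2_def)

lemma Qpoly_u_pos: "t \<in> I \<Longrightarrow> Qpoly a (u t) > 0"
  using pos by (intro Qpoly_pos)

lemma S2_pos: "t \<in> I \<Longrightarrow> S2 (u t) > 0"
  unfolding S2_def using pos a_q_pos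
  by (intro sum_pos2[where i = q]) (auto intro!: divide_pos_pos divide_nonneg_pos)

lemma theta'_eq: "t \<in> I \<Longrightarrow> \<theta>' t = - u t * \<psi>' t"
proof -
  assume t: "t \<in> I"
  have "u t * S2 (u t) + S1 (u t) = (\<Sum>j\<in>UNIV. real_of_int (a j))"
    unfolding S1_def S2_def sum_distrib_left sum.distrib[symmetric]
  proof (rule sum.cong[OF refl])
    fix j
    let ?X = "of_int (a j) * u t + 1"
    have "u t * ((of_int (a j))\<^sup>2 / ?X) + of_int (a j) / ?X = of_int (a j) * ?X / ?X"
      by (simp add: add_divide_distrib power2_eq_square algebra_simps)
    also have "\<dots> = of_int (a j)"
      using pos[OF t, of j] by simp
    finally show "u t * ((of_int (a j))\<^sup>2 / ?X) + of_int (a j) / ?X = of_int (a j)" .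
  qed
  then have "S1 (u t) = - u t * S2 (u t)"
    using sum_a_real by linarith
  then show ?thesis
    by (simp add: \<theta>'_def \<psi>'_def)
qed

definition ode_field :: "real \<times> real \<times> real \<Rightarrow> real \<times> real \<times> real" where
  "ode_field y = (2 * sqrt (Qpoly a (fst y)) * cos (fst (snd y)),
     - sqrt (Qpoly a (fst y)) * sin (fst (snd y)) * S1 (fst y),
     - sqrt (Qpoly a (fst y)) * sin (fst (snd y)) * S2 (fst y))"

lemma smooth_ode_field: "Ck_on k {y. \<forall>j. of_int (a j) * fst y + 1 > 0} ode_field"
  unfolding ode_field_def S1_def S2_def Qpoly_def
  by (intro Ck_on_intros) (auto intro!: prod_pos dest: less_imp_neq[symmetric])

lemma smooth_solution: "Ck_on k I u" "Ck_on k I \<theta>" "Ck_on k I \<psi>"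
proof -
  have "Ck_on k I (\<lambda>t. (u t, \<theta> t, \<psi> t))"
  proof (rule Ck_on_ode_solution[OF _ _ smooth_ode_field])
    fix t assume "t \<in> I"
    then show "((\<lambda>t. (u t, \<theta> t, \<psi> t)) has_vector_derivative ode_field (u t, \<theta> t, \<psi> t)) (at t)"
      using derivatives by (auto intro!: has_vector_derivative_Pair
          simp: ode_field_def u'_def \<theta>'_def \<psi>'_def has_real_derivative_iff_has_vector_derivative)
  qed (use pos in auto)
  from Ck_on_fst[OF this] Ck_on_fst[OF Ck_on_snd[OF this]] Ck_on_snd[OF Ck_on_snd[OF this]]
  show "Ck_on k I u" "Ck_on k I \<theta>" "Ck_on k I \<psi>"
    by simp_all
qed

text \<open>The angles with prescribed components x$k for k \<notin> {p, q}, sum s and a-weighted sum \<tau>: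
  the two remaining ones solve a 2 \<times> 2 system of determinant a_q - a_p > 0.\<close>
definition angles :: "real \<Rightarrow> real \<Rightarrow> real^'m \<Rightarrow> 'm \<Rightarrow> real" where
  "angles s \<tau> x j =
    (if j = p then
       (of_int (a q) * (s - (\<Sum>k\<in>K. x$k)) - (\<tau> - (\<Sum>k\<in>K. of_int (a k) * x$k)))
         / (of_int (a q) - of_int (a p))
     else if j = q then
       (\<tau> - (\<Sum>k\<in>K. of_int (a k) * x$k) - of_int (a p) * (s - (\<Sum>k\<in>K. x$k)))
         / (of_int (a q) - of_int (a p))
     else x$j)"

lemma angles_outside: "k \<in> K \<Longrightarrow> angles s \<tau> x k = x$k"
  by (simp add: angles_def)

lemma angles_sums:
  "(\<Sum>j\<in>UNIV. angles s \<tau> x j) = s" "(\<Sum>j\<in>UNIV. of_int (a j) * angles s \<tau> x j) = \<tau>"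
proof -
  let ?\<sigma> = "s - (\<Sum>k\<in>K. x$k)" and ?\<tau> = "\<tau> - (\<Sum>k\<in>K. of_int (a k) * x$k)"
  have pq: "angles s \<tau> x p = (of_int (a q) * ?\<sigma> - ?\<tau>) / (of_int (a q) - of_int (a p))"
    "angles s \<tau> x q = (?\<tau> - of_int (a p) * ?\<sigma>) / (of_int (a q) - of_int (a p))"
    using p_neq_q by (simp_all add: angles_def)
  show "(\<Sum>j\<in>UNIV. angles s \<tau> x j) = s" "(\<Sum>j\<in>UNIV. of_int (a j) * angles s \<tau> x j) = \<tau>"
    using linear_2x2_solution(1,2)[OF a_p_neq_a_q, of ?\<sigma> ?\<tau>]
    unfolding sum_UNIV_split_two[OF p_neq_q] pq by (simp_all add: angles_outside)
qed

lemma angles_eqI: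
  assumes "\<And>k. k \<in> K \<Longrightarrow> \<alpha> k = x$k" and "(\<Sum>j\<in>UNIV. \<alpha> j) = s"
    and "(\<Sum>j\<in>UNIV. of_int (a j) * \<alpha> j) = \<tau>"
  shows "angles s \<tau> x = \<alpha>"
proof -
  have "\<alpha> p + \<alpha> q = s - (\<Sum>k\<in>K. x$k)"
    and "of_int (a p) * \<alpha> p + of_int (a q) * \<alpha> q = \<tau> - (\<Sum>k\<in>K. of_int (a k) * x$k)"
    using assms by (simp_all add: sum_UNIV_split_two[OF p_neq_q])
  then show ?thesis
    using linear_2x2_solution(3)[OF a_p_neq_a_q] assms(1) p_neq_q
    by (auto simp: fun_eq_iff angles_def)
qed

lemma has_derivative_angles:
  assumes "(s has_derivative s') (at x)" and "(\<tau> has_derivative \<tau>') (at x)"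
  shows "((\<lambda>x. angles (s x) (\<tau> x) x j) has_derivative (\<lambda>v. angles (s' v) (\<tau>' v) v j)) (at x)"
  unfolding angles_def using assms a_p_neq_a_q
  by (cases "j = p"; cases "j = q") (auto intro!: derivative_eq_intros)

lemma Ck_on_angles:
  assumes "Ck_on k U s" and "Ck_on k U \<tau>"
  shows "Ck_on k U (\<lambda>x. angles (s x) (\<tau> x) x j)"
  unfolding angles_def using assms a_p_neg a_q_pos
  by (cases "j = p"; cases "j = q") (auto intro!: Ck_on_intros)

lemma time_derivatives:
  assumes "x$q \<in> I"
  shows "((\<lambda>x. u (x$q)) has_derivative (\<lambda>v. v$q * u' (x$q))) (at x)"
    "((\<lambda>x. \<theta> (x$q)) has_derivative (\<lambda>v. v$q * \<theta>' (x$q))) (at x)"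
    "((\<lambda>x. \<psi> (x$q)) has_derivative (\<lambda>v. v$q * \<psi>' (x$q))) (at x)"
  using derivatives[OF assms] by (auto intro: DERIV_compose_FDERIV[OF _ has_derivative_vec_nth])

definition chart_domain :: "(real^'m) set" where
  "chart_domain = {x. 0 < x$p \<and> x$q \<in> I}"

lemma open_chart_domain: "open chart_domain"
  unfolding chart_domain_def greaterThanLessThan_iff
  by (intro open_Collect_conj open_Collect_less continuous_intros)

lemma Ck_on_time: "Ck_on k I f \<Longrightarrow> Ck_on k chart_domain (\<lambda>x. f (x$q))"
  by (rule Ck_on_compose[OF _ Ck_on_vec_nth]) (auto simp: chart_domain_def)

definition phase :: "real^'m \<Rightarrow> 'm \<Rightarrow> real" where
  "phase x = angles (\<theta> (x$q)) (\<psi> (x$q)) x"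

text \<open>The coordinates are r = x$p, t = x$q and the free angles x$k, k \<notin> {p, q}; the component
  r e^(i \<alpha>_j) sqrt (a_j u(t) + 1) is written as a single exponential.\<close>
definition chart :: "real^'m \<Rightarrow> complex^'m" where
  "chart x = (\<chi> j. exp (of_real (ln (x$p) + ln (of_int (a j) * u (x$q) + 1) / 2)
                         + \<i> * of_real (phase x j)))"

lemma chart_component:
  assumes "x \<in> chart_domain"
  shows "chart x $ j =
    of_real (x$p) * exp (\<i> * of_real (phase x j)) * of_real (sqrt (of_int (a j) * u (x$q) + 1))"
proof -
  have "x$p > 0" "of_int (a j) * u (x$q) + 1 > 0"
    using assms pos[of "x$q" j] by (auto simp: chart_domain_def)
  then show ?thesis
    unfolding chart_def vec_lambda_beta exp_add exp_of_real by (simp add: exp_half_ln)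
qed

lemma image_chart:
  "chart ` chart_domain =
     {z. \<exists>r t (\<alpha> :: 'm \<Rightarrow> real).
        r > 0 \<and> t \<in> I \<and> (\<Sum>j\<in>UNIV. \<alpha> j) = \<theta> t \<and> (\<Sum>j\<in>UNIV. of_int (a j) * \<alpha> j) = \<psi> t \<and>
        z = (\<chi> j. of_real r * exp (\<i> * of_real (\<alpha> j)) * of_real (sqrt (of_int (a j) * u t + 1)))}"
  (is "_ = ?N")
proof
  show "chart ` chart_domain \<subseteq> ?N"
  proof (rule image_subsetI)
    fix x assume x: "x \<in> chart_domain"
    show "chart x \<in> ?N"
      using x angles_sums
      by (intro CollectI exI[of _ "x$p"] exI[of _ "x$q"] exI[of _ "phase x"])
        (auto simp: chart_domain_def phase_def vec_eq_iff chart_component)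
  qed
  show "?N \<subseteq> chart ` chart_domain"
  proof
    fix z assume "z \<in> ?N"
    then obtain r t \<alpha> where "r > 0" "t \<in> I" "(\<Sum>j\<in>UNIV. \<alpha> j) = \<theta> t"
      "(\<Sum>j\<in>UNIV. of_int (a j) * \<alpha> j) = \<psi> t"
      and z: "z = (\<chi> j. of_real r * exp (\<i> * of_real (\<alpha> j))
                         * of_real (sqrt (of_int (a j) * u t + 1)))"
      by blast
    moreover define x :: "real^'m" where "x = (\<chi> j. if j = p then r else if j = q then t else \<alpha> j)"
    ultimately have "x \<in> chart_domain" and "phase x = \<alpha>"
      using p_neq_q
      by (auto simp: chart_domain_def phase_def x_def intro!: angles_eqI split: if_splits)
    then show "z \<in> chart ` chart_domain"
      using p_neq_q
      by (auto simp: z image_iff vec_eq_iff chart_component x_def intro!: bexI[of _ x])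
  qed
qed

lemma smooth_chart: "smooth_on chart_domain chart"
  unfolding smooth_on_def chart_def phase_def
proof
  fix k
  have "x$p > 0" "of_int (a j) * u (x$q) + 1 > 0" if "x \<in> chart_domain" for x j
    using that pos by (auto simp: chart_domain_def)
  then show "Ck_on k chart_domain
      (\<lambda>x. \<chi> j. exp (of_real (ln (x$p) + ln (of_int (a j) * u (x$q) + 1) / 2)
                     + \<i> * of_real (angles (\<theta> (x$q)) (\<psi> (x$q)) x j)))"
    by (intro Ck_on_intros Ck_on_angles Ck_on_time smooth_solution) auto
qed

definition log_rate :: "'m \<Rightarrow> real \<Rightarrow> real" where
  "log_rate j t = of_int (a j) * u' t / (of_int (a j) * u t + 1) / 2"

lemma log_rate_deriv:
  "t \<in> I \<Longrightarrow> ((\<lambda>t. ln (of_int (a j) * u t + 1) / 2) has_real_derivative log_rate j t) (at t)"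
  using pos[of t j] derivatives(1)[of t]
  by (auto intro!: derivative_eq_intros simp: log_rate_def field_simps)

definition stretch :: "real^'m \<Rightarrow> 'm \<Rightarrow> real^'m \<Rightarrow> real" where
  "stretch x j v = v$p / x$p + v$q * log_rate j (x$q)"

definition turn :: "real^'m \<Rightarrow> 'm \<Rightarrow> real^'m \<Rightarrow> real" where
  "turn x j v = angles (v$q * \<theta>' (x$q)) (v$q * \<psi>' (x$q)) v j"

definition log_deriv :: "real^'m \<Rightarrow> 'm \<Rightarrow> real^'m \<Rightarrow> complex" where
  "log_deriv x j v = of_real (stretch x j v) + \<i> * of_real (turn x j v)"

definition Dchart :: "real^'m \<Rightarrow> real^'m \<Rightarrow> complex^'m" where
  "Dchart x v = (\<chi> j. chart x $ j * log_deriv x j v)"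

lemma has_derivative_chart:
  assumes x: "x \<in> chart_domain"
  shows "(chart has_derivative Dchart x) (at x)"
proof -
  have X: "x$p > 0" "x$q \<in> I" "of_int (a j) * u (x$q) + 1 > 0" for j
    using x pos by (auto simp: chart_domain_def)
  have "((\<lambda>x. ln (x$p) + ln (of_int (a j) * u (x$q) + 1) / 2) has_derivative stretch x j) (at x)"
    for j
    using DERIV_compose_FDERIV[OF DERIV_ln[OF X(1)] has_derivative_vec_nth]
      DERIV_compose_FDERIV[OF log_rate_deriv[OF X(2)] has_derivative_vec_nth]
    unfolding stretch_def[abs_def] divide_inverse by (rule has_derivative_add)
  moreover have "((\<lambda>x. phase x j) has_derivative turn x j) (at x)" for j
    unfolding phase_def turn_def[abs_def] using time_derivatives(2,3)[OF X(2)]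
    by (rule has_derivative_angles)
  ultimately have "((\<lambda>x. of_real (ln (x$p) + ln (of_int (a j) * u (x$q) + 1) / 2)
        + \<i> * of_real (phase x j)) has_derivative log_deriv x j) (at x)" for j
    unfolding log_deriv_def[abs_def]
    by (intro has_derivative_add has_derivative_mult_right
        bounded_linear.has_derivative[OF bounded_linear_of_real])
  from has_derivative_compose[OF this has_field_derivative_imp_has_derivative[OF DERIV_exp]]
  show ?thesis
    unfolding chart_def Dchart_def by (auto intro!: has_derivative_vec_lambda)
qed

lemma turn_outside: "k \<in> K \<Longrightarrow> turn x k v = v$k"
  by (simp add: turn_def angles_outside)

lemma turn_sums:
  "(\<Sum>j\<in>UNIV. turn x j v) = v$q * \<theta>' (x$q)"
  "(\<Sum>j\<in>UNIV. of_int (a j) * turn x j v) = v$q * \<psi>' (x$q)"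
  unfolding turn_def by (rule angles_sums)+

lemma cnj_chart_mult_chart:
  assumes "x \<in> chart_domain"
  shows "cnj (chart x $ j) * chart x $ j = of_real ((x$p)\<^sup>2 * (of_int (a j) * u (x$q) + 1))"
proof -
  have "x$p > 0" "of_int (a j) * u (x$q) + 1 > 0"
    using assms pos by (auto simp: chart_domain_def)
  then have "cmod (chart x $ j) = x$p * sqrt (of_int (a j) * u (x$q) + 1)"
    using assms by (simp add: chart_component norm_mult)
  then show ?thesis
    using \<open>of_int (a j) * u (x$q) + 1 > 0\<close>
    by (simp add: complex_norm_square[symmetric] mult.commute power_mult_distrib)
qed

text \<open>The right-hand side is symmetric in v and w because u \<psi>' + \<theta>' = 0; this is what makes the
  Kahler form vanish on the tangent vectors.\<close>
lemma weighted_stretch_turn: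
  assumes "x \<in> chart_domain"
  shows "(\<Sum>j\<in>UNIV. (of_int (a j) * u (x$q) + 1) * stretch x j v * turn x j w)
    = v$q * w$q * u' (x$q) * \<psi>' (x$q) / 2"
proof -
  let ?t = "x$q"
  have t: "?t \<in> I"
    using assms by (simp add: chart_domain_def)
  have "(of_int (a j) * u ?t + 1) * stretch x j v
      = v$p / x$p * (u ?t * of_int (a j) + 1) + v$q * u' ?t / 2 * of_int (a j)" for j
    using pos[OF t, of j] by (simp add: stretch_def log_rate_def field_simps)
  then have "(\<Sum>j\<in>UNIV. (of_int (a j) * u ?t + 1) * stretch x j v * turn x j w)
      = v$p / x$p * (u ?t * (\<Sum>j\<in>UNIV. of_int (a j) * turn x j w) + (\<Sum>j\<in>UNIV. turn x j w))
        + v$q * u' ?t / 2 * (\<Sum>j\<in>UNIV. of_int (a j) * turn x j w)"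
    by (simp add: algebra_simps sum.distrib sum_distrib_left)
  also have "\<dots> = v$q * w$q * u' ?t * \<psi>' ?t / 2"
    unfolding turn_sums theta'_eq[OF t] by (simp add: algebra_simps)
  finally show ?thesis .
qed

lemma kahler_form_Dchart:
  assumes "x \<in> chart_domain"
  shows "kahler_form (Dchart x v) (Dchart x w) = 0"
proof -
  have "Im (cnj (Dchart x v $ j) * Dchart x w $ j) = (x$p)\<^sup>2 *
      ((of_int (a j) * u (x$q) + 1) * stretch x j v * turn x j w
       - (of_int (a j) * u (x$q) + 1) * stretch x j w * turn x j v)" for j
  proof -
    have "cnj (Dchart x v $ j) * Dchart x w $ j
        = (cnj (chart x $ j) * chart x $ j) * (cnj (log_deriv x j v) * log_deriv x j w)"
      by (simp add: Dchart_def ac_simps)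
    also have "\<dots> = of_real ((x$p)\<^sup>2 * (of_int (a j) * u (x$q) + 1))
        * (cnj (log_deriv x j v) * log_deriv x j w)"
      unfolding cnj_chart_mult_chart[OF assms] ..
    finally have product: "cnj (Dchart x v $ j) * Dchart x w $ j = \<dots>" .
    show ?thesis
      unfolding product by (simp add: log_deriv_def algebra_simps)
  qed
  then show ?thesis
    by (simp add: kahler_form_def sum_subtractf weighted_stretch_turn[OF assms]
        flip: sum_distrib_left)
qed

lemma prod_chart:
  assumes "x \<in> chart_domain"
  shows "(\<Prod>j\<in>UNIV. chart x $ j) =
    of_real (x$p ^ CARD('m) * sqrt (Qpoly a (u (x$q)))) * exp (\<i> * of_real (\<theta> (x$q)))"
proof -
  have "(\<Prod>j\<in>UNIV. exp (\<i> * of_real (phase x j))) = exp (\<i> * of_real (\<theta> (x$q)))"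
    by (simp add: phase_def angles_sums flip: exp_sum sum_distrib_left of_real_sum)
  then show ?thesis
    using assms
    by (simp add: chart_component prod.distrib Qpoly_def real_sqrt_prod flip: of_real_prod)
qed

lemma log_deriv_sums:
  "(\<Sum>j\<in>UNIV. log_deriv x j v) = of_real (\<Sum>j\<in>UNIV. stretch x j v) + \<i> * of_real (v$q * \<theta>' (x$q))"
  "(\<Sum>j\<in>UNIV. of_int (a j) * log_deriv x j v)
    = of_real (\<Sum>j\<in>UNIV. of_int (a j) * stretch x j v) + \<i> * of_real (v$q * \<psi>' (x$q))"
  by (simp_all add: log_deriv_def sum.distrib sum_distrib_left algebra_simps flip: turn_sums)

lemma stretch_axis:
  "stretch x j (axis k 1) =
    (if k = p then 1 / x$p else 0) + (if k = q then log_rate j (x$q) else 0)"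
  by (simp add: stretch_def axis_nth_if)

text \<open>Row operations replacing rows p and q of the matrix of logarithmic derivatives by the sum of
  all rows and the a-weighted sum: by the two angle constraints, the angle columns k \<notin> {p, q}
  become i e_k, leaving a 2 \<times> 2 determinant.\<close>
lemma det_log_deriv_matrix:
  assumes "x \<in> chart_domain"
  shows "(of_int (a q) - of_int (a p)) * det (\<chi> j k. log_deriv x j (axis k 1))
    = \<i> ^ card K * of_real (CARD('m) / x$p) *
      (of_real (\<Sum>j\<in>UNIV. of_int (a j) * log_rate j (x$q)) + \<i> * of_real (\<psi>' (x$q)))"
proof -
  let ?C = "\<chi> j k. log_deriv x j (axis k 1)"
  let ?L = "\<chi> i j. if i = p then 1 else if i = q then of_int (a j)
                    else if j = i then 1 else (0 :: complex)"
  let ?T = "transpose (?L ** ?C)"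
  have "det ?L = of_int (a q) - of_int (a p)"
    using det_diagonal_outside_two_rows[OF p_neq_q, of ?L "\<lambda>_. 1"] p_neq_q by simp
  moreover have T: "?T$k$i = (if i = p then \<Sum>j\<in>UNIV. log_deriv x j (axis k 1)
      else if i = q then \<Sum>j\<in>UNIV. of_int (a j) * log_deriv x j (axis k 1)
      else log_deriv x i (axis k 1))" for i k
    by (auto simp: transpose_def matrix_matrix_mult_def if_distrib[of "\<lambda>c. c * _"] cong: if_cong)
  have "?T$k$i = (if i = k then \<i> else 0)" if "k \<notin> {p, q}" for i k
  proof -
    have "(\<Sum>j\<in>UNIV. log_deriv x j (axis k 1)) = 0"
      and "(\<Sum>j\<in>UNIV. of_int (a j) * log_deriv x j (axis k 1)) = 0"
      using that by (auto simp: log_deriv_sums stretch_axis axis_nth_if)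
    moreover have "log_deriv x i (axis k 1) = (if i = k then \<i> else 0)" if "i \<notin> {p, q}"
      using that \<open>k \<notin> {p, q}\<close> by (simp add: log_deriv_def stretch_axis turn_outside axis_nth_if)
    ultimately show ?thesis
      using that unfolding T by auto
  qed
  then have "det ?T = \<i> ^ card K * (?T$p$p * ?T$q$q - ?T$p$q * ?T$q$p)"
    by (subst det_diagonal_outside_two_rows[OF p_neq_q]) auto
  moreover have "?T$p$p = of_real (CARD('m) / x$p)" "?T$p$q = 0"
    "?T$q$q = of_real (\<Sum>j\<in>UNIV. of_int (a j) * log_rate j (x$q)) + \<i> * of_real (\<psi>' (x$q))"
    using p_neq_q sum_a
    by (simp_all add: T log_deriv_sums stretch_axis axis_nth_if flip: sum_divide_distrib of_int_sum)
  ultimately show ?thesis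
    by (simp add: det_mul)
qed

lemma weighted_log_rate_sum:
  assumes "t \<in> I"
  shows "(\<Sum>j\<in>UNIV. of_int (a j) * log_rate j t) = sqrt (Qpoly a (u t)) * cos (\<theta> t) * S2 (u t)"
  unfolding S2_def sum_distrib_left
proof (rule sum.cong[OF refl])
  fix j
  let ?X = "of_int (a j) * u t + 1"
  have "?X > 0"
    using pos[OF assms] .
  then show "of_int (a j) * log_rate j t
      = sqrt (Qpoly a (u t)) * cos (\<theta> t) * ((of_int (a j))\<^sup>2 / ?X)"
    by (simp add: log_rate_def u'_def field_simps power2_eq_square)
qed

definition Omega_density :: "real^'m \<Rightarrow> real" where
  "Omega_density x = x$p ^ CARD('m) / x$p * CARD('m) * Qpoly a (u (x$q)) * S2 (u (x$q))
    / (of_int (a q) - of_int (a p))"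

lemma Omega_density_pos: "x \<in> chart_domain \<Longrightarrow> Omega_density x > 0"
  using a_p_neg a_q_pos Qpoly_u_pos[of "x$q"] S2_pos[of "x$q"]
  by (auto simp: Omega_density_def chart_domain_def intro!: divide_pos_pos mult_pos_pos)

lemma Omega_on_Dchart:
  assumes x: "x \<in> chart_domain"
  shows "Omega_on (Dchart x) = \<i> ^ (CARD('m) - 2) * of_real (Omega_density x)"
proof -
  let ?t = "x$q" and ?d = "of_int (a q) - of_int (a p) :: real"
  let ?Q = "Qpoly a (u ?t)" and ?C = "\<chi> j k. log_deriv x j (axis k 1)"
  have t: "?t \<in> I" and "x$p > 0"
    using x by (simp_all add: chart_domain_def)
  have "?d \<noteq> 0"
    using a_p_neq_a_q by simp
  have "?Q > 0"
    using t by (rule Qpoly_u_pos)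
  then have sqrt_sq: "of_real (sqrt ?Q) * of_real (sqrt ?Q) = (of_real ?Q :: complex)"
    by (simp flip: of_real_mult)
  have "(\<chi> j k. Dchart x (axis k 1) $ j) = (\<chi> j. chart x $ j *s (\<chi> k. ?C $ j $ k))"
    by (simp add: vec_eq_iff Dchart_def)
  then have "of_real ?d * Omega_on (Dchart x) = (\<Prod>j\<in>UNIV. chart x $ j) * (of_real ?d * det ?C)"
    by (simp add: Omega_on_def det_rows_mul)
  also have "of_real (sqrt ?Q * cos (\<theta> ?t) * S2 (u ?t)) + \<i> * of_real (\<psi>' ?t)
      = of_real (sqrt ?Q * S2 (u ?t)) * exp (- (\<i> * of_real (\<theta> ?t)))"
    by (simp add: complex_eq_iff Re_exp Im_exp \<psi>'_def)
  then have "of_real ?d * det ?C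
      = \<i> ^ card K * of_real (CARD('m) / x$p * sqrt ?Q * S2 (u ?t)) * exp (- (\<i> * of_real (\<theta> ?t)))"
    using det_log_deriv_matrix[OF x] by (simp add: weighted_log_rate_sum[OF t])
  also have "(\<Prod>j\<in>UNIV. chart x $ j) * \<dots>
      = of_real ?d * (\<i> ^ (CARD('m) - 2) * of_real (Omega_density x))"
    using \<open>?d \<noteq> 0\<close> \<open>x$p > 0\<close>
    by (simp add: Omega_density_def prod_chart[OF x] card_K mult_ac exp_minus_inverse sqrt_sq)
  finally show ?thesis
    using \<open>?d \<noteq> 0\<close> by (metis mult_left_cancel of_real_eq_0_iff)
qed

lemma special_lagrangian_chart_image:
  "special_lagrangian (\<i> ^ (CARD('m) - 2)) (chart ` chart_domain)"
  using open_chart_domain smooth_chart has_derivative_chart kahler_form_Dchart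
  by (rule special_lagrangian_image)
    (use Omega_on_Dchart Omega_density_pos in \<open>auto simp: norm_power\<close>)

end

theorem theorem7p2:
  fixes a :: "'m::{finite,linorder} \<Rightarrow> int"
    and \<epsilon> :: real and u \<theta> \<psi> :: "real \<Rightarrow> real"
  assumes m3: "CARD('m::{finite,linorder}) \<ge> 3"
    and a_mono: "mono a"
    and a_nz: "\<exists>j. a j \<noteq> 0"
    and a_gcd: "Gcd (range a) = 1"
    and a_sum: "(\<Sum>j\<in>UNIV. a j) = 0"
    and eps: "\<epsilon> > 0"
    and pos: "\<And>j t. t \<in> {-\<epsilon><..<\<epsilon>} \<Longrightarrow> of_int (a j) * u t + 1 > 0"
    and du: "\<And>t. t \<in> {-\<epsilon><..<\<epsilon>} \<Longrightarrow>
              (u has_real_derivative (2 * sqrt (Qpoly a (u t)) * cos (\<theta> t))) (at t)"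
    and dtheta: "\<And>t. t \<in> {-\<epsilon><..<\<epsilon>} \<Longrightarrow>
              (\<theta> has_real_derivative
                 (- sqrt (Qpoly a (u t)) * sin (\<theta> t) *
                    (\<Sum>j\<in>UNIV. of_int (a j) / (of_int (a j) * u t + 1)))) (at t)"
    and dpsi: "\<And>t. t \<in> {-\<epsilon><..<\<epsilon>} \<Longrightarrow>
              (\<psi> has_real_derivative
                 (- sqrt (Qpoly a (u t)) * sin (\<theta> t) *
                    (\<Sum>j\<in>UNIV. (of_int (a j))\<^sup>2 / (of_int (a j) * u t + 1)))) (at t)"
  shows "special_lagrangian (\<i> ^ (CARD('m::{finite,linorder}) - 2))
           {z :: complex^('m::{finite,linorder}). \<exists>r t (\<alpha> :: 'm \<Rightarrow> real).
              r > 0 \<and> t \<in> {-\<epsilon><..<\<epsilon>} \<and>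
              (\<Sum>j\<in>UNIV. \<alpha> j) = \<theta> t \<and>
              (\<Sum>j\<in>UNIV. of_int (a j) * \<alpha> j) = \<psi> t \<and>
              z = (\<chi> j. complex_of_real r * exp (\<i> * complex_of_real (\<alpha> j)) *
                         complex_of_real (sqrt (of_int (a j) * u t + 1)))}"
proof -
  obtain p q where "a p < 0" "a q > 0"
    using sum_eq_0_obtains_neg_pos[of UNIV a] a_sum a_nz by auto
  then interpret sl_evolution a \<epsilon> u \<theta> \<psi> p q
    using a_sum pos du dtheta dpsi by unfold_locales
  show ?thesis
    using special_lagrangian_chart_image unfolding image_chart .
qed

end
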